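(* Let $X$ be a compact Hausdorff space and let $A,B\in\mathbb{K}(C(X))$ be two normal multiplicity-free elements with $\mathrm{Eig}(A(x))=\mathrm{Eig}(B(x))$ for all $x\in X$. Then $A$ and $B$ are strongly unitarily equivalent if and only if the map $\Phi_{A,B}:X\to C$ lifts to a continuous map $\tilde\Phi_{A,B}:X\to E$, i.e. there is a continuous map $\tilde\Phi_{A,B}:X\to E$ with $\pi\circ\tilde\Phi_{A,B}=\Phi_{A,B}$.
   Context: $H$ is a separable infinite-dimensional complex Hilbert space with a fixed orthonormal basis. $\mathbb{K}(C(X))$ is the ring of compact operators over $X$, i.e. norm limits of (finite) matrices with entries in $C(X)$; each $A\in\mathbb{K}(C(X))$ gives a norm-continuous family $x\mapsto A(x)$ of compact operators on $H$. $A$ is normal if every $A(x)$ is normal. $\mathrm{Eig}(A(x))$ is the set of eigenvalues of $A(x)$. $A$ is multiplicity-free if for every $x\in X$ every eigenvalue of $A(x)$ has multiplicity one. $\mathbb{U}(SC(X))$ is the set of families $\{U(x)\}_{x\in X}$ of unitaries in $B(H)$ such that $x\mapsto U(x)v$ is continuous for each $v\in H$. $A$ and $B$ are strongly unitarily equivalent if there is $U\in\mathbb{U}(SC(X))$ with $B(x)=U(x)^*A(x)U(x)$ for all $x\in X$. The space $C$: the set of triples $(\mathcal{P},\mathcal{Q},\sigma)$ where $\mathcal{P}$ and $\mathcal{Q}$ are sets of pairwise orthogonal rank-one (orthogonal) projections in $B(H)$ with $\sum_{p\in\mathcal P}p=I$ and $\sum_{q\in\mathcal Q}q=I$ (strong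 limits of sums over finite subsets), and $\sigma:\mathcal{P}\to\mathcal{Q}$ is a bijection. $C$ carries the topology of the metric $$d((\mathcal{P},\mathcal{Q},\sigma),(\tilde{\mathcal{P}},\tilde{\mathcal{Q}},\tilde\sigma))=\inf_{\tau}\ \sup\{\|p-\tau(p)\|,\ \|\sigma(p)-\tilde\sigma\tau(p)\| : p\in\mathcal{P}\},$$ the infimum over all bijections $\tau:\mathcal{P}\to\tilde{\mathcal{P}}$. Let $\mathbb{U}(H)$ be the unitary group of $H$ with the strong operator topology, let $$E=\{((\mathcal{P},\mathcal{Q},\sigma),U)\in C\times\mathbb{U}(H): UpU^*=\sigma(p)\ \ \forall p\in\mathcal{P}\}$$ with the topology induced from the product, and let $\pi:E\to C$ be $\pi((\mathcal{P},\mathcal{Q},\sigma),U)=(\mathcal{P},\mathcal{Q},\sigma)$. The map $\Phi_{A,B}$: for $x\in X$ and $\lambda\in\mathrm{Eig}(A(x))=\mathrm{Eig}(B(x))$, let $P(x)_\lambda$ and $Q(x)_\lambda$ be the eigenprojections of $A(x)$ and $B(x)$ for $\lambda$. Then $\Phi_{A,B}(x)=(\mathcal{P},\mathcal{Q},\sigma)\in C$, where $\mathcal{P}=\{P(x)_\lambda\}$, $\mathcal{Q}=\{Q(x)_\lambda\}$ and $\sigma(P(x)_\lambda)=Q(x)_\lambda$ for all $\lambda\in \mathrm{Eig}(A(x))$. It is regarded as a continuous map $X\to C$.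
   Formalization: Continuity of Φ_{A,B}: X→C is made an explicit hypothesis; it does not follow from the assumptions on A and B, and without it "only if" fails (A=B, eigenvectors of small eigenvalues rotated by 45° arbitrarily near a point). *)

theory Defs
  imports "HOL-Analysis.Analysis"
begin

section \<open>Complex Hilbert spaces\<close>

text \<open>The distribution only has real inner product spaces. The scalar product below is conjugate
  linear in its first argument; the norm is the one of the underlying real normed space.\<close>

class complex_vector = real_vector +
  fixes scaleC :: "complex \<Rightarrow> 'a \<Rightarrow> 'a" (infixr "*\<^sub>C" 75)
  assumes scaleC_add_right: "a *\<^sub>C (x + y) = a *\<^sub>C x + a *\<^sub>C y"
    and scaleC_add_left: "(a + b) *\<^sub>C x = a *\<^sub>C x + b *\<^sub>C x"
    and scaleC_scaleC: "a *\<^sub>C b *\<^sub>C x = (a * b) *\<^sub>C x"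
    and scaleC_one: "1 *\<^sub>C x = x"
    and scaleR_scaleC: "r *\<^sub>R x = complex_of_real r *\<^sub>C x"

class complex_inner = complex_vector + real_normed_vector +
  fixes cinner :: "'a \<Rightarrow> 'a \<Rightarrow> complex"
  assumes cinner_commute: "cinner x y = cnj (cinner y x)"
    and cinner_add_right: "cinner x (y + z) = cinner x y + cinner x z"
    and cinner_scaleC_right: "cinner x (c *\<^sub>C y) = c * cinner x y"
    and cinner_ge_zero: "0 \<le> Re (cinner x x)"
    and cinner_eq_zero_iff: "cinner x x = 0 \<longleftrightarrow> x = 0"
    and norm_eq_sqrt_cinner: "norm x = sqrt (Re (cinner x x))"

class chilbert_space = complex_inner + complete_space

global_interpretation complex_vector: vector_space "scaleC :: complex \<Rightarrow> 'a \<Rightarrow> 'a::complex_vector"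
  by unfold_locales (simp_all add: scaleC_add_right scaleC_add_left scaleC_scaleC scaleC_one)

text \<open>An orthonormal basis indexed by \<^typ>\<open>nat\<close>: its existence says exactly that the Hilbert space
  is separable and infinite-dimensional.\<close>

definition orthonormal_basis :: "(nat \<Rightarrow> 'h::chilbert_space) \<Rightarrow> bool" where
  "orthonormal_basis e \<longleftrightarrow>
     (\<forall>i j. cinner (e i) (e j) = (if i = j then 1 else 0)) \<and>
     closure (complex_vector.span (range e)) = UNIV"


section \<open>Bounded operators\<close>

text \<open>\<open>B(H)\<close> sits inside the library's space of bounded real-linear operators, from which it inherits
  the operator norm, composition, and the strong operator topology.\<close>

definition bounded_ops :: "('h::chilbert_space \<Rightarrow>\<^sub>L 'h) set" where
  "bounded_ops = {T. \<forall>c v. blinfun_apply T (c *\<^sub>C v) = c *\<^sub>C blinfun_apply T v}"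

definition adj :: "('h::chilbert_space \<Rightarrow>\<^sub>L 'h) \<Rightarrow> ('h \<Rightarrow>\<^sub>L 'h)" where
  "adj T = (THE S. S \<in> bounded_ops \<and>
     (\<forall>v w. cinner (blinfun_apply S v) w = cinner v (blinfun_apply T w)))"

definition normal_op :: "('h::chilbert_space \<Rightarrow>\<^sub>L 'h) \<Rightarrow> bool" where
  "normal_op T \<longleftrightarrow> T \<in> bounded_ops \<and> adj T o\<^sub>L T = T o\<^sub>L adj T"

definition unitaries :: "('h::chilbert_space \<Rightarrow>\<^sub>L 'h) set" where
  "unitaries = {U \<in> bounded_ops. adj U o\<^sub>L U = id_blinfun \<and> U o\<^sub>L adj U = id_blinfun}"

definition orth_projection :: "('h::chilbert_space \<Rightarrow>\<^sub>L 'h) \<Rightarrow> bool" where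
  "orth_projection p \<longleftrightarrow> p \<in> bounded_ops \<and> p o\<^sub>L p = p \<and>
     (\<forall>v w. cinner (blinfun_apply p v) w = cinner v (blinfun_apply p w))"

definition eigenspace :: "('h::chilbert_space \<Rightarrow>\<^sub>L 'h) \<Rightarrow> complex \<Rightarrow> 'h set" where
  "eigenspace T l = {v. blinfun_apply T v = l *\<^sub>C v}"

definition Eig :: "('h::chilbert_space \<Rightarrow>\<^sub>L 'h) \<Rightarrow> complex set" where
  "Eig T = {l. \<exists>v. v \<noteq> 0 \<and> v \<in> eigenspace T l}"

definition eigenprojection :: "('h::chilbert_space \<Rightarrow>\<^sub>L 'h) \<Rightarrow> complex \<Rightarrow> ('h \<Rightarrow>\<^sub>L 'h)" where
  "eigenprojection T l = (THE p. orth_projection p \<and> range (blinfun_apply p) = eigenspace T l)"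

text \<open>The library's \<open>dim\<close> is 0 on infinite-dimensional spaces, so \<open>dim = 1\<close> does mean
  one-dimensional (over the complex numbers).\<close>

definition multiplicity_free_op :: "('h::chilbert_space \<Rightarrow>\<^sub>L 'h) \<Rightarrow> bool" where
  "multiplicity_free_op T \<longleftrightarrow> (\<forall>l\<in>Eig T. complex_vector.dim (eigenspace T l) = 1)"


section \<open>Families of operators over a space\<close>

text \<open>Only the values of a family on the points of the space \<open>X\<close> matter. The \<open>(i, j)\<close> entry of an
  operator \<open>T\<close> is \<open>cinner (e i) (T (e j))\<close>.\<close>

definition finite_matrices ::
  "(nat \<Rightarrow> 'h::chilbert_space) \<Rightarrow> 'x topology \<Rightarrow> ('x \<Rightarrow> ('h \<Rightarrow>\<^sub>L 'h)) set" where
  "finite_matrices e X = {M.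
     (\<forall>x\<in>topspace X. M x \<in> bounded_ops) \<and>
     (\<exists>n. \<forall>x\<in>topspace X. \<forall>i j. n \<le> i \<or> n \<le> j \<longrightarrow> cinner (e i) (blinfun_apply (M x) (e j)) = 0) \<and>
     (\<forall>i j. continuous_map X euclidean (\<lambda>x. cinner (e i) (blinfun_apply (M x) (e j))))}"

text \<open>\<open>K(C(X))\<close>: the limits of such matrices in the norm \<open>sup\<^sub>x \<parallel>M x\<parallel>\<close>.\<close>

definition compact_families ::
  "(nat \<Rightarrow> 'h::chilbert_space) \<Rightarrow> 'x topology \<Rightarrow> ('x \<Rightarrow> ('h \<Rightarrow>\<^sub>L 'h)) set" where
  "compact_families e X = {A.
     (\<forall>x\<in>topspace X. A x \<in> bounded_ops) \<and>
     (\<forall>\<epsilon>>0. \<exists>M\<in>finite_matrices e X. \<forall>x\<in>topspace X. norm (A x - M x) < \<epsilon>)}"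

definition normal_family :: "'x topology \<Rightarrow> ('x \<Rightarrow> ('h::chilbert_space \<Rightarrow>\<^sub>L 'h)) \<Rightarrow> bool" where
  "normal_family X A \<longleftrightarrow> (\<forall>x\<in>topspace X. normal_op (A x))"

definition multiplicity_free :: "'x topology \<Rightarrow> ('x \<Rightarrow> ('h::chilbert_space \<Rightarrow>\<^sub>L 'h)) \<Rightarrow> bool" where
  "multiplicity_free X A \<longleftrightarrow> (\<forall>x\<in>topspace X. multiplicity_free_op (A x))"

definition strong_unitary_families :: "'x topology \<Rightarrow> ('x \<Rightarrow> ('h::chilbert_space \<Rightarrow>\<^sub>L 'h)) set" where
  "strong_unitary_families X = {U.
     (\<forall>x\<in>topspace X. U x \<in> unitaries) \<and>
     (\<forall>v. continuous_map X euclidean (\<lambda>x. blinfun_apply (U x) v))}"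

definition strongly_unitarily_equivalent ::
  "'x topology \<Rightarrow> ('x \<Rightarrow> ('h::chilbert_space \<Rightarrow>\<^sub>L 'h)) \<Rightarrow> ('x \<Rightarrow> ('h \<Rightarrow>\<^sub>L 'h)) \<Rightarrow> bool" where
  "strongly_unitarily_equivalent X A B \<longleftrightarrow>
     (\<exists>U\<in>strong_unitary_families X. \<forall>x\<in>topspace X. B x = adj (U x) o\<^sub>L A x o\<^sub>L U x)"


section \<open>The space \<open>C\<close>\<close>

definition projection_frame :: "('h::chilbert_space \<Rightarrow>\<^sub>L 'h) set \<Rightarrow> bool" where
  "projection_frame P \<longleftrightarrow>
     (\<forall>p\<in>P. orth_projection p \<and> complex_vector.dim (range (blinfun_apply p)) = 1) \<and>
     (\<forall>p\<in>P. \<forall>q\<in>P. p \<noteq> q \<longrightarrow> p o\<^sub>L q = 0) \<and>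
     (\<forall>v. ((\<lambda>p. blinfun_apply p v) has_sum v) P)"

type_synonym 'h frame_pair =
  "('h \<Rightarrow>\<^sub>L 'h) set \<times> ('h \<Rightarrow>\<^sub>L 'h) set \<times> (('h \<Rightarrow>\<^sub>L 'h) \<Rightarrow> ('h \<Rightarrow>\<^sub>L 'h))"

text \<open>A map with domain \<open>P\<close> is represented by a function that is \<^term>\<open>undefined\<close> outside \<open>P\<close>, so that
  equality of triples is equality of the maps on \<open>P\<close>.\<close>

definition frame_pairs :: "'h::chilbert_space frame_pair set" where
  "frame_pairs = {(P, Q, \<sigma>). projection_frame P \<and> projection_frame Q \<and>
     bij_betw \<sigma> P Q \<and> \<sigma> \<in> extensional P}"

text \<open>The value 0 outside the carrier is only there because \<^locale>\<open>Metric_space\<close> requires symmetry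
  and nonnegativity on the whole type.\<close>

definition frame_dist :: "'h::chilbert_space frame_pair \<Rightarrow> 'h frame_pair \<Rightarrow> real" where
  "frame_dist = (\<lambda>(P, Q, \<sigma>) (P', Q', \<sigma>').
     if (P, Q, \<sigma>) \<in> frame_pairs \<and> (P', Q', \<sigma>') \<in> frame_pairs
     then INF \<tau>\<in>{\<tau>. bij_betw \<tau> P P'}.
            Sup ({norm (p - \<tau> p) | p. p \<in> P} \<union> {norm (\<sigma> p - \<sigma>' (\<tau> p)) | p. p \<in> P})
     else 0)"

subsection \<open>\<open>frame_dist\<close> is a metric\<close>

context complex_inner
begin

lemma cinner_add_left: "cinner (x + y) z = cinner x z + cinner y z"
  using cinner_commute[of "x + y" z] cinner_commute[of x z] cinner_commute[of y z]
  by (simp add: cinner_add_right)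

lemma cinner_scaleC_left: "cinner (c *\<^sub>C x) y = cnj c * cinner x y"
  using cinner_commute[of "c *\<^sub>C x" y] cinner_commute[of x y] by (simp add: cinner_scaleC_right)

lemma cinner_zero_right [simp]: "cinner x 0 = 0"
  using cinner_add_right[of x 0 0] by simp

lemma cinner_zero_left [simp]: "cinner 0 x = 0"
  using cinner_add_left[of 0 0 x] by simp

lemma cinner_diff_right: "cinner x (y - z) = cinner x y - cinner x z"
  using cinner_add_right[of x "y - z" z] by simp

lemma cinner_sum_right: "cinner x (sum f A) = (\<Sum>a\<in>A. cinner x (f a))"
  by (induction A rule: infinite_finite_induct) (simp_all add: cinner_add_right)

lemma cinner_sum_left: "cinner (sum f A) x = (\<Sum>a\<in>A. cinner (f a) x)"
  by (induction A rule: infinite_finite_induct) (simp_all add: cinner_add_left)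

lemma norm_sq_cinner: "(norm x)\<^sup>2 = Re (cinner x x)"
  using norm_eq_sqrt_cinner[of x] cinner_ge_zero[of x] by simp

lemma pythagoras:
  assumes "cinner x y = 0"
  shows "(norm (x + y))\<^sup>2 = (norm x)\<^sup>2 + (norm y)\<^sup>2"
proof -
  have "cinner y x = 0" using assms cinner_commute[of y x] by simp
  then show ?thesis using assms by (simp add: norm_sq_cinner cinner_add_left cinner_add_right)
qed

end

lemma orth_projection_norm_le:
  assumes "orth_projection p"
  shows "norm p \<le> 1"
proof (rule norm_blinfun_bound)
  fix v
  have pp: "blinfun_apply p (blinfun_apply p v) = blinfun_apply p v"
    using assms unfolding orth_projection_def by (metis blinfun_apply_blinfun_compose)
  have "cinner (blinfun_apply p v) (v - blinfun_apply p v) = 0"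
    using assms unfolding orth_projection_def by (metis blinfun.diff_right cinner_zero_right pp right_minus_eq)
  from pythagoras[OF this] have "(norm (blinfun_apply p v))\<^sup>2 \<le> (norm v)\<^sup>2" by simp
  then show "norm (blinfun_apply p v) \<le> 1 * norm v" using power2_le_imp_le by simp
qed simp

lemma projection_frame_nonzero:
  assumes "projection_frame P" "p \<in> P"
  shows "p \<noteq> 0"
proof
  assume "p = 0"
  then have "range (blinfun_apply p) \<subseteq> complex_vector.span {}" by auto
  then have "complex_vector.dim (range (blinfun_apply p)) \<le> card ({} :: 'a set)"
    by (rule complex_vector.dim_le_card) simp
  then show False using assms unfolding projection_frame_def by auto
qed

lemma projection_frame_dist_ge:
  assumes "projection_frame P" "p \<in> P" "q \<in> P" "p \<noteq> q"
  shows "1 \<le> norm (p - q)"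
proof -
  obtain v where v: "blinfun_apply q v \<noteq> 0"
    using projection_frame_nonzero[OF assms(1,3)] by (metis blinfun_eqI zero_blinfun.rep_eq)
  let ?w = "blinfun_apply q v"
  have "q o\<^sub>L q = q" "p o\<^sub>L q = 0"
    using assms unfolding projection_frame_def orth_projection_def by auto
  then have "blinfun_apply q ?w = ?w" "blinfun_apply p ?w = 0"
    by (metis blinfun_apply_blinfun_compose, metis blinfun_apply_blinfun_compose zero_blinfun.rep_eq)
  then have "norm ?w = norm (blinfun_apply (p - q) ?w)"
    by (simp add: blinfun.diff_left)
  also have "\<dots> \<le> norm (p - q) * norm ?w" by (rule norm_blinfun)
  finally show ?thesis using v by simp
qed

lemma projection_frame_diff_le:
  assumes "projection_frame P" "p \<in> P" "projection_frame Q" "q \<in> Q"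
  shows "norm (p - q) \<le> 2"
  using norm_triangle_ineq4[of p q] orth_projection_norm_le[of p] orth_projection_norm_le[of q] assms
  unfolding projection_frame_def by force

lemma projection_frame_cinner:
  assumes "projection_frame P" "p \<in> P" "q \<in> P" "p \<noteq> q"
  shows "cinner (blinfun_apply p v) (blinfun_apply q w) = 0"
proof -
  have "cinner (blinfun_apply p v) (blinfun_apply q w) = cinner v (blinfun_apply (p o\<^sub>L q) w)"
    using assms unfolding projection_frame_def orth_projection_def
    by (metis blinfun_apply_blinfun_compose)
  also have "p o\<^sub>L q = 0" using assms unfolding projection_frame_def by blast
  finally show ?thesis by simp
qed

lemma projection_frame_countable:
  assumes e: "orthonormal_basis (e :: nat \<Rightarrow> 'h::chilbert_space)"
    and P: "projection_frame (P :: ('h \<Rightarrow>\<^sub>L 'h) set)"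
  shows "countable P"
proof -
  have fin: "(norm (\<Sum>p\<in>F. blinfun_apply p v))\<^sup>2 = (\<Sum>p\<in>F. (norm (blinfun_apply p v))\<^sup>2)"
    if "finite F" "F \<subseteq> P" for F v
    using that
  proof (induction F rule: finite_induct)
    case (insert p F)
    have "cinner (blinfun_apply p v) (\<Sum>q\<in>F. blinfun_apply q v) = 0"
      unfolding cinner_sum_right
    proof (intro sum.neutral ballI projection_frame_cinner[OF P])
      fix q assume "q \<in> F"
      with insert show "p \<in> P" "q \<in> P" "p \<noteq> q" by auto
    qed
    from pythagoras[OF this] insert show ?case by simp
  qed simp
  have "countable {p\<in>P. (norm (blinfun_apply p v))\<^sup>2 \<noteq> 0}" for v
  proof (rule summable_countable_real)
    have "((\<lambda>F. \<Sum>p\<in>F. blinfun_apply p v) \<longlongrightarrow> v) (finite_subsets_at_top P)"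
      using P unfolding projection_frame_def has_sum_def by blast
    then have "((\<lambda>F. (norm (\<Sum>p\<in>F. blinfun_apply p v))\<^sup>2) \<longlongrightarrow> (norm v)\<^sup>2) (finite_subsets_at_top P)"
      by (intro tendsto_intros)
    then have "((\<lambda>F. \<Sum>p\<in>F. (norm (blinfun_apply p v))\<^sup>2) \<longlongrightarrow> (norm v)\<^sup>2) (finite_subsets_at_top P)"
      by (rule Lim_transform_eventually)
        (auto simp: fin intro!: eventually_finite_subsets_at_top_weakI)
    then show "(\<lambda>p. (norm (blinfun_apply p v))\<^sup>2) summable_on P"
      unfolding summable_on_def has_sum_def by blast
  qed
  then have "countable (\<Union>n. {p\<in>P. (norm (blinfun_apply p (e n)))\<^sup>2 \<noteq> 0})" by blast
  moreover have "\<exists>n. blinfun_apply p (e n) \<noteq> 0" if "p \<in> P" for p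
  proof (rule ccontr)
    assume z: "\<not> ?thesis"
    have "blinfun_apply p v = 0" if "v \<in> complex_vector.span (range e)" for v
      using that
    proof (induction rule: complex_vector.span_induct_alt)
      case (step c x y)
      have "blinfun_apply p (c *\<^sub>C x) = c *\<^sub>C blinfun_apply p x"
        using P \<open>p \<in> P\<close> unfolding projection_frame_def orth_projection_def bounded_ops_def by blast
      with step z show ?case by (auto simp: blinfun.add_right)
    qed (simp add: blinfun.zero_right)
    then have "complex_vector.span (range e) \<subseteq> {v. blinfun_apply p v = 0}" by blast
    moreover have "closed {v. blinfun_apply p v = 0}"
      by (intro closed_Collect_eq continuous_intros)
    ultimately have "closure (complex_vector.span (range e)) \<subseteq> {v. blinfun_apply p v = 0}"
      by (rule closure_minimal)
    then have "p = 0" using e unfolding orthonormal_basis_def by (auto intro!: blinfun_eqI)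
    then show False using projection_frame_nonzero[OF P that] by blast
  qed
  ultimately show ?thesis by (elim countable_subset[rotated]) auto
qed

lemma projection_frame_infinite:
  assumes e: "orthonormal_basis (e :: nat \<Rightarrow> 'h::chilbert_space)"
    and P: "projection_frame (P :: ('h \<Rightarrow>\<^sub>L 'h) set)"
  shows "infinite P"
proof
  assume fin: "finite P"
  have "\<exists>b. finite b \<and> range (blinfun_apply p) \<subseteq> complex_vector.span b" if "p \<in> P" for p
  proof -
    obtain b where b: "complex_vector.independent b" "range (blinfun_apply p) \<subseteq> complex_vector.span b"
      "card b = complex_vector.dim (range (blinfun_apply p))"
      using complex_vector.basis_exists by metis
    then have "card b = 1" using P that unfolding projection_frame_def by auto
    then have "finite b" using card.infinite[of b] by fastforce
    then show ?thesis using b(2) by blast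
  qed
  then obtain b where b: "\<And>p. p \<in> P \<Longrightarrow> finite (b p)"
    "\<And>p. p \<in> P \<Longrightarrow> range (blinfun_apply p) \<subseteq> complex_vector.span (b p)" by metis
  let ?T = "\<Union>p\<in>P. b p"
  have T: "finite ?T" using fin b by blast
  have "v \<in> complex_vector.span ?T" for v
  proof -
    have "((\<lambda>p. blinfun_apply p v) has_sum v) P" using P unfolding projection_frame_def by blast
    then have v: "v = (\<Sum>p\<in>P. blinfun_apply p v)"
      using fin has_sum_finite[of P "\<lambda>p. blinfun_apply p v"] has_sum_unique by metis
    show ?thesis
    proof (subst v, rule complex_vector.span_sum)
      fix p assume "p \<in> P"
      then have "blinfun_apply p v \<in> complex_vector.span (b p)" using b by blast
      also have "\<dots> \<subseteq> complex_vector.span ?T" using \<open>p \<in> P\<close> by (intro complex_vector.span_mono) blast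
      finally show "blinfun_apply p v \<in> complex_vector.span ?T" .
    qed
  qed
  then have sub: "range e \<subseteq> complex_vector.span ?T" by blast
  have ee: "cinner (e i) (e j) = (if i = j then 1 else 0)" for i j
    using e unfolding orthonormal_basis_def by blast
  have inj: "e i = e j \<Longrightarrow> i = j" for i j using ee by (metis zero_neq_one)
  have ind: "complex_vector.independent (range e)"
  proof
    assume "complex_vector.dependent (range e)"
    then obtain F u v where F: "finite F" "F \<subseteq> range e" "(\<Sum>w\<in>F. u w *\<^sub>C w) = 0" "v \<in> F" "u v \<noteq> 0"
      unfolding complex_vector.dependent_explicit by blast
    then obtain i where i: "v = e i" by blast
    have "0 = cinner v (\<Sum>w\<in>F. u w *\<^sub>C w)" by (simp add: F)
    also have "\<dots> = (\<Sum>w\<in>F. u w * cinner v w)" by (simp add: cinner_sum_right cinner_scaleC_right)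
    also have "\<dots> = (\<Sum>w\<in>F. if w = v then u v else 0)"
    proof (rule sum.cong[OF refl])
      fix w assume "w \<in> F"
      then obtain j where "w = e j" using F by blast
      then show "u w * cinner v w = (if w = v then u v else 0)" by (cases "i = j") (auto simp: i ee dest: inj)
    qed
    also have "\<dots> = u v" using F by simp
    finally show False using F by simp
  qed
  have "finite (range e)" using complex_vector.independent_span_bound[OF T ind sub] by blast
  moreover have "inj e" using inj by (rule injI)
  ultimately show False using finite_imageD infinite_UNIV_nat by blast
qed

lemma frame_pairsD:
  assumes "(P, Q, \<sigma>) \<in> frame_pairs"
  shows "projection_frame P" "projection_frame Q" "bij_betw \<sigma> P Q" "\<sigma> \<in> extensional P"
  using assms unfolding frame_pairs_def by auto

lemma frame_dist_aux:
  assumes e: "orthonormal_basis (e :: nat \<Rightarrow> 'h::chilbert_space)"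
    and c: "(P, Q, \<sigma>) \<in> frame_pairs" and c': "(P', Q', \<sigma>') \<in> (frame_pairs :: 'h frame_pair set)"
  shows frame_dist_less: "frame_dist (P, Q, \<sigma>) (P', Q', \<sigma>') < r \<Longrightarrow>
      \<exists>\<tau>. bij_betw \<tau> P P' \<and> (\<forall>p\<in>P. norm (p - \<tau> p) < r \<and> norm (\<sigma> p - \<sigma>' (\<tau> p)) < r)"
    and frame_dist_le: "bij_betw \<tau> P P' \<Longrightarrow>
      (\<And>p. p \<in> P \<Longrightarrow> norm (p - \<tau> p) \<le> r \<and> norm (\<sigma> p - \<sigma>' (\<tau> p)) \<le> r) \<Longrightarrow>
      frame_dist (P, Q, \<sigma>) (P', Q', \<sigma>') \<le> r"
    and frame_dist_nonneg: "0 \<le> frame_dist (P, Q, \<sigma>) (P', Q', \<sigma>')"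
proof -
  note D = frame_pairsD[OF c] and D' = frame_pairsD[OF c']
  let ?S = "\<lambda>\<tau>. {norm (p - \<tau> p) | p. p \<in> P} \<union> {norm (\<sigma> p - \<sigma>' (\<tau> p)) | p. p \<in> P}"
  let ?T = "{\<tau>. bij_betw \<tau> P P'}"
  have d: "frame_dist (P, Q, \<sigma>) (P', Q', \<sigma>') = (INF \<tau>\<in>?T. Sup (?S \<tau>))"
    using c c' by (simp add: frame_dist_def)
  have "infinite P" "countable P" "infinite P'" "countable P'"
    using projection_frame_infinite[OF e] projection_frame_countable[OF e] D D' by blast+
  then obtain f g where "bij_betw f P (UNIV :: nat set)" "bij_betw g (UNIV :: nat set) P'"
    by (meson countableE_infinite countable_infiniteE')
  then have T: "?T \<noteq> {}" using bij_betw_trans by blast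
  obtain p0 where p0: "p0 \<in> P" using \<open>infinite P\<close> by fastforce
  have bdd: "bdd_above (?S \<tau>)" if "bij_betw \<tau> P P'" for \<tau>
  proof (rule bdd_aboveI[where M = 2])
    fix y assume "y \<in> ?S \<tau>"
    then obtain p where p: "p \<in> P" "y = norm (p - \<tau> p) \<or> y = norm (\<sigma> p - \<sigma>' (\<tau> p))" by blast
    then have "\<tau> p \<in> P'" "\<sigma> p \<in> Q" "\<sigma>' (\<tau> p) \<in> Q'" using that D D' by (meson bij_betwE)+
    with p show "y \<le> 2"
      using projection_frame_diff_le[of P p P' "\<tau> p"] projection_frame_diff_le[of Q "\<sigma> p" Q' "\<sigma>' (\<tau> p)"] D D'
      by auto
  qed
  have up: "y \<le> Sup (?S \<tau>)" if "y \<in> ?S \<tau>" "bij_betw \<tau> P P'" for y \<tau>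
    using cSup_upper[OF that(1) bdd[OF that(2)]] .
  have S0: "0 \<le> Sup (?S \<tau>)" if "bij_betw \<tau> P P'" for \<tau>
  proof -
    have "norm (p0 - \<tau> p0) \<le> Sup (?S \<tau>)" using p0 that by (intro up) blast+
    then show ?thesis using norm_ge_zero order_trans by blast
  qed
  then have Tb: "bdd_below ((\<lambda>\<tau>. Sup (?S \<tau>)) ` ?T)" by (intro bdd_belowI[where m = 0]) auto
  show "0 \<le> frame_dist (P, Q, \<sigma>) (P', Q', \<sigma>')"
    unfolding d using T S0 by (intro cINF_greatest) auto
  show "\<exists>\<tau>. bij_betw \<tau> P P' \<and> (\<forall>p\<in>P. norm (p - \<tau> p) < r \<and> norm (\<sigma> p - \<sigma>' (\<tau> p)) < r)"
    if less: "frame_dist (P, Q, \<sigma>) (P', Q', \<sigma>') < r"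
  proof -
    obtain \<tau> where t: "bij_betw \<tau> P P'" "Sup (?S \<tau>) < r"
      using less unfolding d cINF_less_iff[OF T Tb] by blast
    have "norm (p - \<tau> p) < r \<and> norm (\<sigma> p - \<sigma>' (\<tau> p)) < r" if "p \<in> P" for p
      using up[of "norm (p - \<tau> p)" \<tau>] up[of "norm (\<sigma> p - \<sigma>' (\<tau> p))" \<tau>] that t by fastforce
    with t show ?thesis by blast
  qed
  show "frame_dist (P, Q, \<sigma>) (P', Q', \<sigma>') \<le> r"
    if t: "bij_betw \<tau> P P'"
      and le: "\<And>p. p \<in> P \<Longrightarrow> norm (p - \<tau> p) \<le> r \<and> norm (\<sigma> p - \<sigma>' (\<tau> p)) \<le> r"
  proof -
    have "(INF \<tau>\<in>?T. Sup (?S \<tau>)) \<le> Sup (?S \<tau>)" using Tb t by (intro cINF_lower) auto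
    also have "\<dots> \<le> r" using p0 le by (intro cSup_least) auto
    finally show ?thesis unfolding d .
  qed
qed

lemma frame_dist_commute_le:
  assumes e: "orthonormal_basis (e :: nat \<Rightarrow> 'h::chilbert_space)"
    and c: "(P, Q, \<sigma>) \<in> frame_pairs" and c': "(P', Q', \<sigma>') \<in> (frame_pairs :: 'h frame_pair set)"
  shows "frame_dist (P, Q, \<sigma>) (P', Q', \<sigma>') \<le> frame_dist (P', Q', \<sigma>') (P, Q, \<sigma>)"
proof (rule dense_ge)
  fix r assume "frame_dist (P', Q', \<sigma>') (P, Q, \<sigma>) < r"
  from frame_dist_less[OF e c' c this] obtain \<tau> where t: "bij_betw \<tau> P' P"
    "\<And>p. p \<in> P' \<Longrightarrow> norm (p - \<tau> p) < r" "\<And>p. p \<in> P' \<Longrightarrow> norm (\<sigma>' p - \<sigma> (\<tau> p)) < r" by blast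
  let ?t = "inv_into P' \<tau>"
  show "frame_dist (P, Q, \<sigma>) (P', Q', \<sigma>') \<le> r"
  proof (rule frame_dist_le[OF e c c'])
    show "bij_betw ?t P P'" using t bij_betw_inv_into by blast
    fix p assume "p \<in> P"
    then have "?t p \<in> P'" "\<tau> (?t p) = p"
      using t by (metis bij_betw_imp_surj_on inv_into_into, metis bij_betw_inv_into_right)
    with t(2,3)[of "?t p"] show "norm (p - ?t p) \<le> r \<and> norm (\<sigma> p - \<sigma>' (?t p)) \<le> r"
      by (simp add: norm_minus_commute)
  qed
qed

lemma frame_dist_eq_0_imp:
  assumes e: "orthonormal_basis (e :: nat \<Rightarrow> 'h::chilbert_space)"
    and c: "(P, Q, \<sigma>) \<in> frame_pairs" and c': "(P', Q', \<sigma>') \<in> (frame_pairs :: 'h frame_pair set)"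
    and 0: "frame_dist (P, Q, \<sigma>) (P', Q', \<sigma>') = 0"
  shows "(P, Q, \<sigma>) = (P', Q', \<sigma>')"
proof -
  note D = frame_pairsD[OF c] and D' = frame_pairsD[OF c']
  have ex: "\<exists>\<tau>. bij_betw \<tau> P P' \<and> (\<forall>p\<in>P. norm (p - \<tau> p) < r \<and> norm (\<sigma> p - \<sigma>' (\<tau> p)) < r)"
    if "0 < r" for r
    using frame_dist_less[OF e c c'] 0 that by simp
  obtain \<tau> where t: "bij_betw \<tau> P P'" "\<And>p. p \<in> P \<Longrightarrow> norm (p - \<tau> p) < 1/2"
    using ex[of "1/2"] by auto
  have close: "norm (p - \<tau> p) < r \<and> norm (\<sigma> p - \<sigma>' (\<tau> p)) < r" if rp: "0 < r" "p \<in> P" for r p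
  proof -
    obtain \<rho> where rho: "bij_betw \<rho> P P'"
      "norm (p - \<rho> p) < min r (1/2)" "norm (\<sigma> p - \<sigma>' (\<rho> p)) < min r (1/2)"
      using ex[of "min r (1/2)"] rp by auto
    have "norm (\<rho> p - \<tau> p) \<le> norm (p - \<rho> p) + norm (p - \<tau> p)"
      by (metis norm_minus_commute norm_triangle_sub dist_norm dist_triangle3)
    also have "\<dots> < 1" using rho t(2)[OF \<open>p \<in> P\<close>] by simp
    finally have "\<rho> p = \<tau> p"
      using projection_frame_dist_ge[OF D'(1), of "\<rho> p" "\<tau> p"] that rho(1) t(1) by (force dest: bij_betwE)
    with rho show ?thesis by simp
  qed
  have tp: "\<tau> p = p" "\<sigma> p = \<sigma>' (\<tau> p)" if "p \<in> P" for p
    using close[OF _ that, of "norm (p - \<tau> p)"] close[OF _ that, of "norm (\<sigma> p - \<sigma>' (\<tau> p))"]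
    by (auto, metis)
  have P: "P' = P" using t(1) tp(1) by (metis bij_betw_imp_surj_on image_cong image_ident)
  have "\<sigma> = \<sigma>'" using D(4) D'(4) tp P by (metis extensionalityI)
  moreover have "Q = Q'" using D(3) D'(3) P \<open>\<sigma> = \<sigma>'\<close> by (metis bij_betw_imp_surj_on)
  ultimately show ?thesis using P by simp
qed

lemma frame_dist_triangle:
  assumes e: "orthonormal_basis (e :: nat \<Rightarrow> 'h::chilbert_space)"
    and c: "(P, Q, \<sigma>) \<in> frame_pairs" and c': "(P', Q', \<sigma>') \<in> (frame_pairs :: 'h frame_pair set)"
    and c'': "(P'', Q'', \<sigma>'') \<in> frame_pairs"
  shows "frame_dist (P, Q, \<sigma>) (P'', Q'', \<sigma>'') \<le>
    frame_dist (P, Q, \<sigma>) (P', Q', \<sigma>') + frame_dist (P', Q', \<sigma>') (P'', Q'', \<sigma>'')"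
    (is "?d \<le> ?d1 + ?d2")
proof (rule field_le_epsilon)
  fix \<epsilon> :: real assume "0 < \<epsilon>"
  then have "?d1 < ?d1 + \<epsilon>/2" "?d2 < ?d2 + \<epsilon>/2" by auto
  then obtain s t where
    s: "bij_betw s P P'" "\<And>p. p \<in> P \<Longrightarrow> norm (p - s p) < ?d1 + \<epsilon>/2"
      "\<And>p. p \<in> P \<Longrightarrow> norm (\<sigma> p - \<sigma>' (s p)) < ?d1 + \<epsilon>/2" and
    t: "bij_betw t P' P''" "\<And>p. p \<in> P' \<Longrightarrow> norm (p - t p) < ?d2 + \<epsilon>/2"
      "\<And>p. p \<in> P' \<Longrightarrow> norm (\<sigma>' p - \<sigma>'' (t p)) < ?d2 + \<epsilon>/2"
    using frame_dist_less[OF e c c'] frame_dist_less[OF e c' c''] by metis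
  show "?d \<le> ?d1 + ?d2 + \<epsilon>"
  proof (rule frame_dist_le[OF e c c''])
    show "bij_betw (t \<circ> s) P P''" using s t bij_betw_trans by blast
    fix p assume p: "p \<in> P"
    then have "s p \<in> P'" using s by (meson bij_betwE)
    then show "norm (p - (t \<circ> s) p) \<le> ?d1 + ?d2 + \<epsilon> \<and> norm (\<sigma> p - \<sigma>'' ((t \<circ> s) p)) \<le> ?d1 + ?d2 + \<epsilon>"
      using s(2,3)[OF p] t(2,3)[of "s p"]
        norm_triangle_ineq[of "p - s p" "s p - t (s p)"]
        norm_triangle_ineq[of "\<sigma> p - \<sigma>' (s p)" "\<sigma>' (s p) - \<sigma>'' (t (s p))"]
      by auto
  qed
qed

lemma Metric_space_frame_pairs:
  assumes e: "orthonormal_basis (e :: nat \<Rightarrow> 'h::chilbert_space)"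
  shows "Metric_space (frame_pairs :: 'h frame_pair set) frame_dist"
proof
  fix x y z :: "'h frame_pair"
  obtain P Q \<sigma> P' Q' \<sigma>' P'' Q'' \<sigma>'' where
    xyz: "x = (P, Q, \<sigma>)" "y = (P', Q', \<sigma>')" "z = (P'', Q'', \<sigma>'')" by (metis surj_pair)
  have out: "frame_dist x y = 0" "frame_dist y x = 0" if "x \<notin> frame_pairs \<or> y \<notin> frame_pairs"
    using that unfolding xyz frame_dist_def by auto
  show "0 \<le> frame_dist x y" using out frame_dist_nonneg[OF e] xyz by (metis order_refl)
  show "frame_dist x y = frame_dist y x"
    using out frame_dist_commute_le[OF e] xyz by (metis order_antisym)
  show "frame_dist x z \<le> frame_dist x y + frame_dist y z"
    if "x \<in> frame_pairs" "y \<in> frame_pairs" "z \<in> frame_pairs"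
    using frame_dist_triangle[OF e] that xyz by metis
  assume in_C: "x \<in> frame_pairs" "y \<in> frame_pairs"
  have "frame_dist x x \<le> 0"
    unfolding xyz by (rule frame_dist_le[OF e, where \<tau> = id]) (use in_C xyz in auto)
  then have "frame_dist x x = 0" using frame_dist_nonneg[OF e] in_C xyz by (metis order_antisym)
  then show "frame_dist x y = 0 \<longleftrightarrow> x = y"
    using frame_dist_eq_0_imp[OF e] in_C xyz by metis
qed

text \<open>\<open>Metric_space_frame_pairs\<close> is what makes \<^const>\<open>Metric_space.mtopology\<close> meaningful here.\<close>

definition frame_topology :: "'h::chilbert_space frame_pair topology" where
  "frame_topology = Metric_space.mtopology frame_pairs frame_dist"


section \<open>The space \<open>E\<close> and the map \<open>\<Phi>\<close>\<close>

definition total_space :: "('h::chilbert_space frame_pair \<times> ('h \<Rightarrow>\<^sub>L 'h)) set" where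
  "total_space = {((P, Q, \<sigma>), U). (P, Q, \<sigma>) \<in> frame_pairs \<and> U \<in> unitaries \<and>
     (\<forall>p\<in>P. U o\<^sub>L p o\<^sub>L adj U = \<sigma> p)}"

definition total_topology :: "('h::chilbert_space frame_pair \<times> ('h \<Rightarrow>\<^sub>L 'h)) topology" where
  "total_topology = subtopology
     (prod_topology frame_topology (subtopology strong_operator_topology unitaries)) total_space"

definition bundle_proj :: "'h::chilbert_space frame_pair \<times> ('h \<Rightarrow>\<^sub>L 'h) \<Rightarrow> 'h frame_pair" where
  "bundle_proj = fst"

text \<open>The map \<open>P(x)\<^sub>\<lambda> \<mapsto> Q(x)\<^sub>\<lambda>\<close> is written through the inverse of \<open>\<lambda> \<mapsto> P(x)\<^sub>\<lambda>\<close>, which is injective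
  because eigenspaces of eigenvalues are nonzero and meet in 0. Continuity of \<open>Phi A B\<close> for
  \<^const>\<open>frame_topology\<close> does not follow from norm continuity of \<open>A\<close> and \<open>B\<close>: eigenvectors belonging
  to the small eigenvalues may turn by a fixed angle arbitrarily close to a given point. It is a
  hypothesis wherever \<open>\<Phi>\<close> is regarded as a continuous map.\<close>

definition Phi ::
  "('x \<Rightarrow> ('h::chilbert_space \<Rightarrow>\<^sub>L 'h)) \<Rightarrow> ('x \<Rightarrow> ('h \<Rightarrow>\<^sub>L 'h)) \<Rightarrow> 'x \<Rightarrow> 'h frame_pair" where
  "Phi A B x =
     (eigenprojection (A x) ` Eig (A x),
      eigenprojection (B x) ` Eig (B x),
      restrict
        (\<lambda>p. eigenprojection (B x) (the_inv_into (Eig (A x)) (eigenprojection (A x)) p))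
        (eigenprojection (A x) ` Eig (A x)))"

end

theory Submission
  imports Defs
begin

text \<open>Fix a point \<open>x\<close> and write \<open>P\<^sub>l\<close>, \<open>Q\<^sub>l\<close> for the eigenprojections of \<open>A x\<close>, \<open>B x\<close>. Conjugation by a
  unitary carries eigenspaces to eigenspaces, so \<open>B x = U\<^sup>* (A x) U\<close> forces \<open>U\<^sup>* P\<^sub>l U = Q\<^sub>l\<close> for every
  eigenvalue \<open>l\<close>. Conversely, these identities make \<open>B x\<close> and \<open>U\<^sup>* (A x) U\<close> both act as the scalar \<open>l\<close>
  on the range of \<open>Q\<^sub>l\<close>; since \<open>Phi A B x\<close> lies in the space \<open>C\<close>, the \<open>Q\<^sub>l\<close> sum strongly to the identity,
  and the two bounded operators coincide. This is \<open>conjugate_iff_eigenprojections\<close>. The identities say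
  exactly that \<open>U\<^sup>*\<close> lies in the fibre of \<open>E\<close> over \<open>Phi A B x\<close> (\<open>Phi_in_total_space_iff\<close>).

  Globally, a lift of \<open>Phi A B\<close> to \<open>E\<close> therefore is the same thing as a family \<open>x \<mapsto> W x\<close> of unitaries
  whose adjoints conjugate \<open>A\<close> into \<open>B\<close>, and continuity of the lift is strong continuity of \<open>W\<close>. It
  remains that taking adjoints preserves strong continuity; this fails for general bounded families
  but holds for unitaries (\<open>strong_unitary_families_adj\<close>).

  The eigenprojections and the adjoint are given by definite descriptions, so both have to be shown to
  exist: the former from the explicit projection onto a line (\<open>orth_projection_onto_line\<close>), the latter
  from the Riesz representation theorem (\<open>Re_cinner_bounded_linear_form\<close>).\<close>

section \<open>Adjoints of bounded operators\<close>

lemma cinner_left_eqI: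
  assumes "\<And>w. cinner x w = cinner y w"
  shows "x = y"
proof -
  have "cinner (x - y) (x - y) = 0"
    using assms[of "x - y"] cinner_add_left[of "x - y" y "x - y"] by simp
  then show ?thesis using cinner_eq_zero_iff[of "x - y"] by simp
qed

lemma norm_add_sq_cinner:
  fixes x z :: "'h::complex_inner"
  shows "(norm (x + z))\<^sup>2 = (norm x)\<^sup>2 + 2 * Re (cinner x z) + (norm z)\<^sup>2"
  using cinner_commute[of x z]
  by (simp add: norm_sq_cinner cinner_add_left cinner_add_right complex_eq_iff)

text \<open>The Riesz representation theorem for the underlying real Hilbert space. The representing vector
  is the minimiser of \<open>g y = \<parallel>y\<parallel>\<^sup>2 / 2 - f y\<close>. By the parallelogram law every minimising sequence is
  Cauchy, so a minimiser \<open>z\<close> exists, and the vanishing of the derivative of \<open>g\<close> at \<open>z\<close> in the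
  direction \<open>h\<close> is the equation \<open>Re (cinner z h) = f h\<close>.\<close>

lemma Re_cinner_bounded_linear_form:
  fixes f :: "'h::chilbert_space \<Rightarrow> real"
  assumes f: "bounded_linear f"
  shows "\<exists>y. \<forall>h. f h = Re (cinner y h)"
proof -
  interpret f: bounded_linear f by (rule f)
  define g where "g y = (norm y)\<^sup>2 / 2 - f y" for y
  have Re_scale: "Re (cinner x (t *\<^sub>R z)) = t * Re (cinner x z)" for x z :: 'h and t
    by (simp add: scaleR_scaleC cinner_scaleC_right)
  obtain K where K: "\<And>x. \<bar>f x\<bar> \<le> norm x * K" using f.bounded by (auto simp: abs_real_def)
  have lower: "- K\<^sup>2 / 2 \<le> g y" for y
  proof -
    have "f y \<le> norm y * K" using K[of y] by linarith
    moreover have "0 \<le> (norm y - K)\<^sup>2" by simp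
    ultimately show ?thesis unfolding g_def power2_diff by (simp add: field_simps)
  qed
  define m where "m = (INF y. g y)"
  have bdd: "bdd_below (range g)" using lower by (intro bdd_belowI[where m = "- K\<^sup>2 / 2"]) auto
  have m: "m \<le> g y" for y unfolding m_def using bdd by (intro cINF_lower) auto
  have "\<exists>y. g y < m + 1 / real (Suc n)" for n
  proof -
    have "(INF y. g y) < m + 1 / real (Suc n)" by (simp add: m_def)
    then show ?thesis using bdd by (simp add: cINF_less_iff)
  qed
  then obtain y where y: "\<And>n. g (y n) < m + 1 / real (Suc n)" by metis
  \<comment> \<open>The parallelogram law: the linear part of \<open>g\<close> drops out of its deviation from midpoint affinity.\<close>
  have mid: "(norm (u - v))\<^sup>2 = 4 * (g u + g v - 2 * g ((1/2) *\<^sub>R (u + v)))" for u v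
  proof -
    have "(norm ((1/2) *\<^sub>R (u + v)))\<^sup>2 = (norm (u + v))\<^sup>2 / 4"
      by (simp add: power_divide)
    moreover have "f ((1/2) *\<^sub>R (u + v)) = (f u + f v) / 2"
      by (simp add: f.scaleR f.add)
    moreover have "(norm (u - v))\<^sup>2 = (norm u)\<^sup>2 - 2 * Re (cinner u v) + (norm v)\<^sup>2"
      using norm_add_sq_cinner[of u "- v"] Re_scale[of u "-1" v] by simp
    ultimately show ?thesis unfolding g_def by (simp add: norm_add_sq_cinner)
  qed
  have dist: "(norm (y i - y j))\<^sup>2 \<le> 8 / real (Suc n)" if "n \<le> i" "n \<le> j" for i j n
  proof -
    have "1 / real (Suc i) \<le> 1 / real (Suc n)" "1 / real (Suc j) \<le> 1 / real (Suc n)"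
      using that by (auto intro!: divide_left_mono)
    then have "g (y i) + g (y j) - 2 * g ((1/2) *\<^sub>R (y i + y j)) \<le> 2 * (1 / real (Suc n))"
      using y[of i] y[of j] m[of "(1/2) *\<^sub>R (y i + y j)"] by linarith
    then show ?thesis unfolding mid by simp
  qed
  have "Cauchy y"
  proof (rule CauchyI)
    fix \<epsilon> :: real assume \<epsilon>: "0 < \<epsilon>"
    obtain n where n: "8 / \<epsilon>\<^sup>2 < real (Suc n)" using reals_Archimedean2 less_trans lessI of_nat_less_iff by metis
    then have "8 / real (Suc n) < \<epsilon>\<^sup>2" using \<epsilon> by (simp add: field_simps)
    then have "norm (y i - y j) < \<epsilon>" if "n \<le> i" "n \<le> j" for i j
      using dist[OF that] \<epsilon> by (intro power2_less_imp_less[of _ \<epsilon>]) auto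
    then show "\<exists>M. \<forall>i\<ge>M. \<forall>j\<ge>M. norm (y i - y j) < \<epsilon>" by blast
  qed
  then obtain z where z: "y \<longlonglongrightarrow> z" using Cauchy_convergent convergentD by blast
  have gz: "(\<lambda>n. g (y n)) \<longlonglongrightarrow> g z"
    unfolding g_def by (intro tendsto_intros f.tendsto z) simp
  have "(\<lambda>n. m + 1 / real (Suc n)) \<longlonglongrightarrow> m + 0"
    by (intro tendsto_add tendsto_const LIMSEQ_Suc[OF lim_1_over_n])
  then have "g z \<le> m + 0"
    by (rule LIMSEQ_le[OF gz]) (use y less_imp_le in blast)
  then have min: "g z \<le> g (z + t *\<^sub>R h)" for t h using m by (metis add_0_right order_trans)
  have "f h = Re (cinner z h)" for h
  proof -
    let ?a = "Re (cinner z h) - f h" and ?s = "(norm h)\<^sup>2 + 1"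
    have "0 \<le> t * ?a + t\<^sup>2 * (norm h)\<^sup>2 / 2" for t
      using min[of t h] by (simp add: g_def norm_add_sq_cinner Re_scale f.add f.scaleR power_mult_distrib field_simps)
    \<comment> \<open>A step against the slope \<open>?a\<close>; the summand 1 in \<open>?s\<close> keeps the denominator nonzero for \<open>h = 0\<close>.\<close>
    from this[of "- ?a / ?s"] have "0 \<le> (- ?a / ?s) * ?a + (- ?a / ?s)\<^sup>2 * (norm h)\<^sup>2 / 2" .
    then have "0 \<le> ((- ?a / ?s) * ?a + (- ?a / ?s)\<^sup>2 * (norm h)\<^sup>2 / 2) * (2 * ?s\<^sup>2)"
      by (intro mult_nonneg_nonneg) auto
    also have "\<dots> = - (?a\<^sup>2 * ((norm h)\<^sup>2 + 2))"
    proof -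
      have s: "?s \<noteq> 0" by (metis add_nonneg_pos less_irrefl zero_le_power2 zero_less_one)
      have "(- a / s) * a + (- a / s)\<^sup>2 * n / 2 = - (a\<^sup>2 * (2 * s - n)) / (2 * s\<^sup>2)"
        if "s \<noteq> 0" for a s n :: real using that by (simp add: power2_eq_square field_simps)
      from this[OF s, of ?a "(norm h)\<^sup>2"] show ?thesis using s by simp
    qed
    finally have "?a\<^sup>2 * ((norm h)\<^sup>2 + 2) \<le> 0" by simp
    moreover have "0 < (norm h)\<^sup>2 + 2" by (simp add: add_nonneg_pos)
    ultimately have "?a\<^sup>2 \<le> 0" by (simp add: mult_le_0_iff)
    then show ?thesis by simp
  qed
  then show ?thesis by blast
qed

lemma bounded_opsD:
  "T \<in> bounded_ops \<Longrightarrow> blinfun_apply T (c *\<^sub>C v) = c *\<^sub>C blinfun_apply T v"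
  unfolding bounded_ops_def by blast

lemma bounded_ops_compose:
  "S \<in> bounded_ops \<Longrightarrow> T \<in> bounded_ops \<Longrightarrow> S o\<^sub>L T \<in> bounded_ops"
  unfolding bounded_ops_def by simp

text \<open>The Cauchy--Schwarz inequality for the real part is the triangle inequality, squared.\<close>

lemma Re_cinner_norm_le:
  fixes x y :: "'h::complex_inner"
  shows "\<bar>Re (cinner x y)\<bar> \<le> norm x * norm y"
proof -
  have *: "Re (cinner x z) \<le> norm x * norm z" for z
  proof -
    have "(norm (x + z))\<^sup>2 \<le> (norm x + norm z)\<^sup>2"
      by (intro power_mono norm_triangle_ineq) simp
    then show ?thesis by (simp add: norm_add_sq_cinner power2_sum)
  qed
  have "cinner x (- y) = - cinner x y" using cinner_diff_right[of x 0 y] by simp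
  then show ?thesis using *[of y] *[of "- y"] by simp
qed

text \<open>Riesz' theorem, applied to \<open>w \<mapsto> Re (cinner v (T w))\<close>, yields the value of the adjoint at \<open>v\<close>. Linearity
  follows from uniqueness, boundedness from \<open>\<parallel>S v\<parallel>\<^sup>2 = cinner v (T (S v)) \<le> \<parallel>v\<parallel> \<parallel>T\<parallel> \<parallel>S v\<parallel>\<close>.\<close>

lemma adjoint_exists:
  assumes T: "T \<in> bounded_ops"
  shows "\<exists>S\<in>bounded_ops. \<forall>v w. cinner (blinfun_apply S v) w = cinner v (blinfun_apply T w)"
proof -
  have "\<exists>y. \<forall>w. cinner y w = cinner v (blinfun_apply T w)" for v
  proof -
    have "bounded_linear (\<lambda>w. Re (cinner v (blinfun_apply T w)))"
    proof (rule bounded_linear_intro[where K = "norm v * norm T"])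
      fix w
      have "\<bar>Re (cinner v (blinfun_apply T w))\<bar> \<le> norm v * norm (blinfun_apply T w)"
        by (rule Re_cinner_norm_le)
      also have "\<dots> \<le> norm v * (norm T * norm w)" by (intro mult_left_mono norm_blinfun) simp
      finally show "norm (Re (cinner v (blinfun_apply T w))) \<le> norm w * (norm v * norm T)"
        by (simp add: ac_simps)
    qed (simp_all add: blinfun.add_right blinfun.scaleR_right cinner_add_right scaleR_scaleC
        bounded_opsD[OF T] cinner_scaleC_right)
    from Re_cinner_bounded_linear_form[OF this]
    obtain y where y: "\<And>w. Re (cinner v (blinfun_apply T w)) = Re (cinner y w)" by blast
    \<comment> \<open>The imaginary parts agree as well because \<open>Im z = - Re (\<i> * z)\<close>.\<close>
    have "Im (cinner v (blinfun_apply T w)) = Im (cinner y w)" for w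
      using y[of "\<i> *\<^sub>C w"] by (simp add: bounded_opsD[OF T] cinner_scaleC_right)
    with y show ?thesis by (metis complex_eq_iff)
  qed
  then obtain S where S: "\<And>v w. cinner (S v) w = cinner v (blinfun_apply T w)" by metis
  have add: "S (u + v) = S u + S v" for u v
    by (rule cinner_left_eqI) (simp add: S cinner_add_left)
  have scale: "S (c *\<^sub>C v) = c *\<^sub>C S v" for c v
    by (rule cinner_left_eqI) (simp add: S cinner_scaleC_left)
  have "bounded_linear S"
  proof (rule bounded_linear_intro[where K = "norm T"])
    fix v
    have "(norm (S v))\<^sup>2 = Re (cinner v (blinfun_apply T (S v)))"
      by (simp add: norm_sq_cinner S)
    also have "\<dots> \<le> norm v * norm (blinfun_apply T (S v))"
      using Re_cinner_norm_le abs_le_D1 by blast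
    also have "\<dots> \<le> norm v * (norm T * norm (S v))" by (intro mult_left_mono norm_blinfun) simp
    finally have "norm (S v) * norm (S v) \<le> (norm v * norm T) * norm (S v)"
      by (simp add: power2_eq_square ac_simps)
    then show "norm (S v) \<le> norm v * norm T"
      by (cases "S v = 0") (auto dest: mult_right_le_imp_le)
  qed (simp_all add: add scale scaleR_scaleC)
  then have app: "blinfun_apply (Blinfun S) = S" by (rule bounded_linear_Blinfun_apply)
  show ?thesis by (rule bexI[of _ "Blinfun S"]) (simp_all add: app S scale bounded_ops_def)
qed

lemma adj_eqI:
  assumes "S \<in> bounded_ops"
    and "\<And>v w. cinner (blinfun_apply S v) w = cinner v (blinfun_apply T w)"
  shows "adj T = S"
  unfolding adj_def
proof (rule the_equality)
  fix R assume R: "R \<in> bounded_ops \<and>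
    (\<forall>v w. cinner (blinfun_apply R v) w = cinner v (blinfun_apply T w))"
  show "R = S" by (intro blinfun_eqI cinner_left_eqI) (use R assms in simp)
qed (use assms in blast)

lemma adj_properties:
  assumes "T \<in> bounded_ops"
  shows adj_in_bounded_ops: "adj T \<in> bounded_ops"
    and cinner_adj_left: "cinner (blinfun_apply (adj T) v) w = cinner v (blinfun_apply T w)"
  using adjoint_exists[OF assms] adj_eqI by metis+

lemma cinner_adj_right:
  assumes "T \<in> bounded_ops"
  shows "cinner v (blinfun_apply (adj T) w) = cinner (blinfun_apply T v) w"
  using cinner_adj_left[OF assms, of w v] cinner_commute by metis

lemma adj_adj: "T \<in> bounded_ops \<Longrightarrow> adj (adj T) = T"
  by (rule adj_eqI) (simp_all add: cinner_adj_right)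

section \<open>Families of unitaries\<close>

lemma unitariesD:
  assumes "U \<in> unitaries"
  shows "U \<in> bounded_ops" "adj U \<in> bounded_ops" "adj (adj U) = U"
    and "blinfun_apply (adj U) (blinfun_apply U v) = v"
    and "blinfun_apply U (blinfun_apply (adj U) v) = v"
proof -
  show *: "U \<in> bounded_ops" using assms unfolding unitaries_def by blast
  show "adj U \<in> bounded_ops" "adj (adj U) = U" using * adj_in_bounded_ops adj_adj by blast+
  have "adj U o\<^sub>L U = id_blinfun" "U o\<^sub>L adj U = id_blinfun"
    using assms unfolding unitaries_def by auto
  then show "blinfun_apply (adj U) (blinfun_apply U v) = v"
    "blinfun_apply U (blinfun_apply (adj U) v) = v"
    by (metis blinfun_apply_blinfun_compose blinfun_apply_id_blinfun id_apply)+
qed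

lemma adj_unitary: "U \<in> unitaries \<Longrightarrow> adj U \<in> unitaries"
  using unitariesD(1-3)[of U] unfolding unitaries_def by auto

lemma norm_unitary:
  assumes "U \<in> unitaries"
  shows "norm (blinfun_apply U v) = norm v"
  using cinner_adj_left[OF unitariesD(1)[OF assms], of "blinfun_apply U v" v]
  by (simp add: norm_eq_sqrt_cinner unitariesD[OF assms])

text \<open>With \<open>w = (U a)\<^sup>* v\<close>, and since \<open>U x\<close> is isometric, \<open>\<parallel>(U x)\<^sup>* v - w\<parallel> = \<parallel>v - U x w\<parallel>\<close>. The vector \<open>w\<close>
  does not depend on \<open>x\<close>, so strong continuity of \<open>U\<close> at \<open>a\<close> applies to it and \<open>U x w\<close> tends to
  \<open>U a w = v\<close>.\<close>

lemma strong_unitary_families_adj: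
  assumes "U \<in> strong_unitary_families X"
  shows "(\<lambda>x. adj (U x)) \<in> strong_unitary_families X"
proof -
  have U: "U x \<in> unitaries" if "x \<in> topspace X" for x
    using assms that unfolding strong_unitary_families_def by blast
  have cont: "continuous_map X euclidean (\<lambda>x. blinfun_apply (U x) w)" for w
    using assms unfolding strong_unitary_families_def by blast
  have "continuous_map X euclidean (\<lambda>x. blinfun_apply (adj (U x)) v)" for v
    unfolding continuous_map_atin
  proof (intro ballI)
    fix a assume a: "a \<in> topspace X"
    define w where "w = blinfun_apply (adj (U a)) v"
    have "norm (blinfun_apply (adj (U x)) v - w) = norm (blinfun_apply (U x) w - v)"
      if x: "x \<in> topspace X" for x
      using norm_unitary[OF U[OF x], of "blinfun_apply (adj (U x)) v - w"]
      by (simp add: blinfun.diff_right unitariesD[OF U[OF x]] norm_minus_commute)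
    then have ev: "eventually (\<lambda>x. norm (blinfun_apply (U x) w - v)
        = norm (blinfun_apply (adj (U x)) v - w)) (atin X a)"
      using a by (auto simp: eventually_atin)
    have "blinfun_apply (U a) w = v" by (simp add: w_def unitariesD(5)[OF U[OF a]])
    then have "((\<lambda>x. blinfun_apply (U x) w) \<longlongrightarrow> v) (atin X a)"
      using cont[of w] a by (auto simp: continuous_map_atin)
    then have "((\<lambda>x. norm (blinfun_apply (U x) w - v)) \<longlongrightarrow> 0) (atin X a)"
      by (simp add: tendsto_dist_iff[of _ v] dist_norm)
    then have "((\<lambda>x. norm (blinfun_apply (adj (U x)) v - w)) \<longlongrightarrow> 0) (atin X a)"
      using ev by (rule Lim_transform_eventually)
    then have "((\<lambda>x. blinfun_apply (adj (U x)) v) \<longlongrightarrow> w) (atin X a)"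
      by (simp add: tendsto_dist_iff[of _ w] dist_norm)
    then show "limitin euclidean (\<lambda>x. blinfun_apply (adj (U x)) v)
        (blinfun_apply (adj (U a)) v) (atin X a)"
      by (simp add: w_def)
  qed
  then show ?thesis using U adj_unitary unfolding strong_unitary_families_def by blast
qed

section \<open>Eigenprojections\<close>

lemma orth_projectionD:
  assumes "orth_projection p"
  shows "p \<in> bounded_ops" "blinfun_apply p (blinfun_apply p v) = blinfun_apply p v"
    and "cinner (blinfun_apply p v) w = cinner v (blinfun_apply p w)"
  using assms unfolding orth_projection_def by (auto simp flip: blinfun_apply_blinfun_compose)

text \<open>If \<open>p\<close> and \<open>q\<close> have the same range, then \<open>p q = q\<close> and \<open>q p = p\<close>; taking adjoints in the latter
  gives \<open>p = p q = q\<close>.\<close>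

lemma orth_projection_eqI:
  assumes p: "orth_projection p" and q: "orth_projection q"
    and r: "range (blinfun_apply p) = range (blinfun_apply q)"
  shows "p = q"
proof (intro blinfun_eqI cinner_left_eqI)
  fix v w
  have pq: "blinfun_apply p (blinfun_apply q u) = blinfun_apply q u"
    and qp: "blinfun_apply q (blinfun_apply p u) = blinfun_apply p u" for u
    using r orth_projectionD(2)[OF p] orth_projectionD(2)[OF q] by (metis rangeE rangeI)+
  have "cinner (blinfun_apply p v) w = cinner v (blinfun_apply q (blinfun_apply p w))"
    by (simp add: orth_projectionD(3)[OF p] qp)
  also have "\<dots> = cinner (blinfun_apply p (blinfun_apply q v)) w"
    by (simp add: orth_projectionD(3)[OF p] orth_projectionD(3)[OF q])
  finally show "cinner (blinfun_apply p v) w = cinner (blinfun_apply q v) w" by (simp add: pq)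
qed

lemma eigenprojection_eqI:
  assumes "orth_projection p" "range (blinfun_apply p) = eigenspace T l"
  shows "eigenprojection T l = p"
  unfolding eigenprojection_def
proof (rule the_equality)
  show "q = p" if "orth_projection q \<and> range (blinfun_apply q) = eigenspace T l" for q
    using that assms orth_projection_eqI[of q p] by simp
qed (use assms in simp)

text \<open>The projection is \<open>w \<mapsto> (\<langle>v, w\<rangle> / \<langle>v, v\<rangle>) v\<close>. It is a contraction by Pythagoras, since \<open>w - P w\<close> is
  orthogonal to \<open>P w\<close>.\<close>

lemma orth_projection_onto_line:
  fixes v :: "'h::chilbert_space"
  assumes v: "v \<noteq> 0"
  shows "\<exists>p. orth_projection p \<and> range (blinfun_apply p) = range (\<lambda>c. c *\<^sub>C v)"
proof -
  define P where "P w = (cinner v w / cinner v v) *\<^sub>C v" for w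
  have vv: "cinner v v \<noteq> 0" using v by (simp add: cinner_eq_zero_iff)
  have real: "cnj (cinner v v) = cinner v v" using cinner_commute by metis
  have add: "P (u + w) = P u + P w" for u w
    by (simp add: P_def cinner_add_right add_divide_distrib scaleC_add_left)
  have scale: "P (c *\<^sub>C w) = c *\<^sub>C P w" for c w
    by (simp add: P_def cinner_scaleC_right scaleC_scaleC)
  have fixed: "P (c *\<^sub>C v) = c *\<^sub>C v" for c
    using vv by (simp add: P_def cinner_scaleC_right)
  have "bounded_linear P"
  proof (rule bounded_linear_intro[where K = 1])
    fix w
    have "cinner (P w) (w - P w) = 0"
      using vv by (simp add: P_def cinner_diff_right cinner_scaleC_left cinner_scaleC_right)
    from pythagoras[OF this] have "(norm (P w))\<^sup>2 \<le> (norm w)\<^sup>2" by simp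
    then show "norm (P w) \<le> norm w * 1" using power2_le_imp_le by simp
  qed (simp_all add: add scale scaleR_scaleC)
  then have app: "blinfun_apply (Blinfun P) = P" by (rule bounded_linear_Blinfun_apply)
  have "cinner (P u) w = cinner u (P w)" for u w
    using cinner_commute[of u v] real
    by (simp add: P_def cinner_scaleC_left cinner_scaleC_right)
  moreover have "P (P w) = P w" for w using fixed P_def by metis
  ultimately have "orth_projection (Blinfun P)"
    unfolding orth_projection_def bounded_ops_def by (auto simp: app scale intro!: blinfun_eqI)
  moreover have "range P = range (\<lambda>c. c *\<^sub>C v)"
    using fixed unfolding P_def by (auto simp: image_iff) metis
  ultimately show ?thesis using app by metis
qed

lemma subspace_eigenspace:
  "T \<in> bounded_ops \<Longrightarrow> complex_vector.subspace (eigenspace T l)"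
  unfolding complex_vector.subspace_def eigenspace_def
  by (auto simp: blinfun.zero_right blinfun.add_right scaleC_add_right bounded_opsD scaleC_scaleC
      mult.commute)

lemma eigenspace_line:
  assumes "T \<in> bounded_ops" "complex_vector.dim (eigenspace T l) = 1"
  shows "\<exists>v. v \<noteq> 0 \<and> eigenspace T l = range (\<lambda>c. c *\<^sub>C v)"
proof -
  obtain b where b: "b \<subseteq> eigenspace T l" "complex_vector.independent b"
      "eigenspace T l \<subseteq> complex_vector.span b" "card b = complex_vector.dim (eigenspace T l)"
    using complex_vector.basis_exists by metis
  then obtain v where v: "b = {v}" using assms(2) card_1_singletonE by metis
  have "complex_vector.span b = eigenspace T l"
    using b complex_vector.span_minimal[OF b(1) subspace_eigenspace[OF assms(1)]] by blast
  then show ?thesis using b(2) v complex_vector.span_singleton[of v] by auto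
qed

lemma eigenprojection_properties:
  assumes T: "T \<in> bounded_ops" "multiplicity_free_op T" and l: "l \<in> Eig T"
  shows orth_projection_eigenprojection: "orth_projection (eigenprojection T l)"
    and range_eigenprojection: "range (blinfun_apply (eigenprojection T l)) = eigenspace T l"
proof -
  obtain p where "orth_projection p" "range (blinfun_apply p) = eigenspace T l"
    using eigenspace_line[OF T(1)] orth_projection_onto_line T(2) l
    unfolding multiplicity_free_op_def by metis
  then show "orth_projection (eigenprojection T l)"
    "range (blinfun_apply (eigenprojection T l)) = eigenspace T l"
    using eigenprojection_eqI by metis+
qed

lemma apply_eigenprojection:
  assumes "T \<in> bounded_ops" "multiplicity_free_op T" "l \<in> Eig T"
  shows "blinfun_apply T (blinfun_apply (eigenprojection T l) v)
    = l *\<^sub>C blinfun_apply (eigenprojection T l) v"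
  using range_eigenprojection[OF assms] unfolding eigenspace_def by blast

text \<open>Injectivity is what makes the inverse of \<open>l \<mapsto> P\<^sub>l\<close> in the definition of \<^const>\<open>Phi\<close> meaningful, so
  that its third component does map \<open>P\<^sub>l\<close> to \<open>Q\<^sub>l\<close>.\<close>

lemma inj_on_eigenprojection:
  assumes "T \<in> bounded_ops" "multiplicity_free_op T"
  shows "inj_on (eigenprojection T) (Eig T)"
proof (rule inj_onI)
  fix k l assume kl: "k \<in> Eig T" "l \<in> Eig T" "eigenprojection T k = eigenprojection T l"
  then have same: "eigenspace T k = eigenspace T l" using range_eigenprojection[OF assms] by metis
  obtain v where v: "v \<noteq> 0" "v \<in> eigenspace T k" using kl(1) unfolding Eig_def by blast
  then have "k *\<^sub>C v = l *\<^sub>C v" using same unfolding eigenspace_def by force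
  then show "k = l" using v complex_vector.scale_right_imp_eq by blast
qed

section \<open>Conjugating operators and conjugating eigenprojections\<close>

text \<open>From left to right, \<open>U\<^sup>* P\<^sub>l U\<close> is an orthogonal projection onto \<open>U\<^sup>*\<close> of the eigenspace of \<open>A\<close>, which is
  the eigenspace of \<open>B\<close>. From right to left, the difference of the two operators vanishes on the
  range of each \<open>Q\<^sub>l\<close>, and a bounded operator with this property vanishes because \<open>v = \<Sum>\<^sub>l Q\<^sub>l v\<close>.\<close>

lemma conjugate_iff_eigenprojections:
  assumes A: "A \<in> bounded_ops" "multiplicity_free_op A"
    and B: "B \<in> bounded_ops" "multiplicity_free_op B"
    and Eig: "Eig A = Eig B"
    and frame: "projection_frame (eigenprojection B ` Eig B)"
    and U: "U \<in> unitaries"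
  shows "B = adj U o\<^sub>L A o\<^sub>L U \<longleftrightarrow>
    (\<forall>l\<in>Eig A. adj U o\<^sub>L eigenprojection A l o\<^sub>L U = eigenprojection B l)"
    (is "_ \<longleftrightarrow> (\<forall>l\<in>Eig A. ?Q l = _)")
proof
  note [simp] = unitariesD(4,5)[OF U]
  note [simp] = bounded_opsD[OF unitariesD(1)[OF U]] bounded_opsD[OF unitariesD(2)[OF U]]
  assume BU: "B = adj U o\<^sub>L A o\<^sub>L U"
  show "\<forall>l\<in>Eig A. ?Q l = eigenprojection B l"
  proof
    fix l assume l: "l \<in> Eig A"
    let ?p = "eigenprojection A l"
    have p: "orth_projection ?p" "range (blinfun_apply ?p) = eigenspace A l"
      using eigenprojection_properties[OF A l] .
    have "?Q l \<in> bounded_ops"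
      using unitariesD[OF U] orth_projectionD(1)[OF p(1)] by (intro bounded_ops_compose)
    then have orth: "orth_projection (?Q l)"
      unfolding orth_projection_def
      by (auto intro!: blinfun_eqI simp: orth_projectionD[OF p(1)]
          cinner_adj_left[OF unitariesD(1)[OF U]] cinner_adj_right[OF unitariesD(1)[OF U]])
    have "range (blinfun_apply (?Q l)) = eigenspace B l"
    proof (intro equalityI subsetI)
      fix v assume "v \<in> range (blinfun_apply (?Q l))"
      then show "v \<in> eigenspace B l"
        by (auto simp: eigenspace_def BU apply_eigenprojection[OF A l])
    next
      fix v assume "v \<in> eigenspace B l"
      then have "blinfun_apply (adj U) (blinfun_apply A (blinfun_apply U v)) = l *\<^sub>C v"
        by (simp add: eigenspace_def BU)
      then have "blinfun_apply A (blinfun_apply U v) = l *\<^sub>C blinfun_apply U v"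
        using unitariesD(5)[OF U] bounded_opsD[OF unitariesD(1)[OF U]] by metis
      then have "blinfun_apply U v \<in> range (blinfun_apply ?p)" by (simp add: p(2) eigenspace_def)
      then have "blinfun_apply ?p (blinfun_apply U v) = blinfun_apply U v"
        using orth_projectionD(2)[OF p(1)] by auto
      then have "blinfun_apply (?Q l) v = v" by simp
      then show "v \<in> range (blinfun_apply (?Q l))" by (metis rangeI)
    qed
    with orth show "?Q l = eigenprojection B l" by (simp add: eigenprojection_eqI)
  qed
next
  assume QU: "\<forall>l\<in>Eig A. ?Q l = eigenprojection B l"
  let ?D = "B - (adj U o\<^sub>L A o\<^sub>L U)"
  have D0: "blinfun_apply ?D (blinfun_apply q v) = 0" if q: "q \<in> eigenprojection B ` Eig B" for q v
  proof -
    obtain l where l: "l \<in> Eig A" "l \<in> Eig B" "q = eigenprojection B l" using q Eig by auto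
    have q': "q = ?Q l" using QU l by simp
    have "blinfun_apply (adj U o\<^sub>L A o\<^sub>L U) (blinfun_apply q v) = l *\<^sub>C blinfun_apply q v"
      unfolding q' by (simp add: unitariesD(5)[OF U] apply_eigenprojection[OF A l(1)]
          bounded_opsD[OF unitariesD(2)[OF U]])
    then show ?thesis using apply_eigenprojection[OF B l(2)] l(3) by (simp add: blinfun.diff_left)
  qed
  have "?D = 0"
  proof (rule blinfun_eqI)
    fix v
    have "((\<lambda>q. blinfun_apply q v) has_sum v) (eigenprojection B ` Eig B)"
      using frame unfolding projection_frame_def by blast
    then have "((\<lambda>q. blinfun_apply ?D (blinfun_apply q v)) has_sum blinfun_apply ?D v)
        (eigenprojection B ` Eig B)"
      by (rule has_sum_bounded_linear[OF blinfun.bounded_linear_right, unfolded comp_def])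
    then have "((\<lambda>q. 0) has_sum blinfun_apply ?D v) (eigenprojection B ` Eig B)"
      by (simp add: D0 cong: has_sum_cong)
    then have "blinfun_apply ?D v = 0" using has_sum_unique[OF _ has_sum_0[OF refl]] by simp
    then show "blinfun_apply ?D v = blinfun_apply 0 v" by simp
  qed
  then show "B = adj U o\<^sub>L A o\<^sub>L U" by simp
qed

text \<open>The space \<open>E\<close> asks for \<open>W p W\<^sup>* = \<sigma> p\<close>, whereas unitary equivalence is written \<open>B = U\<^sup>* A U\<close>. Hence the
  element of the fibre is the adjoint of the implementing unitary.\<close>

lemma Phi_in_total_space_iff:
  assumes A: "A x \<in> bounded_ops" "multiplicity_free_op (A x)"
    and B: "B x \<in> bounded_ops" "multiplicity_free_op (B x)"
    and Eig: "Eig (A x) = Eig (B x)"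
    and frame: "Phi A B x \<in> frame_pairs"
    and U: "U \<in> unitaries"
  shows "(Phi A B x, adj U) \<in> total_space \<longleftrightarrow> B x = adj U o\<^sub>L A x o\<^sub>L U"
proof -
  have "projection_frame (eigenprojection (B x) ` Eig (B x))"
    using frame unfolding Phi_def by (rule frame_pairsD(2))
  from conjugate_iff_eigenprojections[OF A B Eig this U] show ?thesis
    using frame adj_unitary[OF U] unitariesD(3)[OF U]
    by (simp add: total_space_def Phi_def the_inv_into_f_f[OF inj_on_eigenprojection[OF A]])
qed

section \<open>Lifts and strong unitary equivalence\<close>

lemma continuous_map_total_topology_iff:
  assumes c: "continuous_map X frame_topology c"
  shows "continuous_map X total_topology (\<lambda>x. (c x, W x)) \<longleftrightarrow>
    W \<in> strong_unitary_families X \<and> (\<forall>x\<in>topspace X. (c x, W x) \<in> total_space)"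
  using c unfolding total_topology_def strong_unitary_families_def continuous_map_in_subtopology
    continuous_map_pairwise comp_def
  by (auto simp: continuous_on_strong_operator_topo_iff_coordinatewise image_subset_iff Pi_iff)

theorem theorem2p7:
  fixes e :: "nat \<Rightarrow> 'h::chilbert_space"
    and X :: "'x topology"
    and A B :: "'x \<Rightarrow> ('h \<Rightarrow>\<^sub>L 'h)"
  assumes "orthonormal_basis e"
    and "compact_space X" and "Hausdorff_space X"
    and "A \<in> compact_families e X" and "B \<in> compact_families e X"
    and "normal_family X A" and "normal_family X B"
    and "multiplicity_free X A" and "multiplicity_free X B"
    and "\<forall>x\<in>topspace X. Eig (A x) = Eig (B x)"
    and "continuous_map X frame_topology (Phi A B)"
  shows "strongly_unitarily_equivalent X A B \<longleftrightarrow>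
    (\<exists>\<Psi>. continuous_map X total_topology \<Psi> \<and>
         (\<forall>x\<in>topspace X. bundle_proj (\<Psi> x) = Phi A B x))"
proof -
  interpret C: Metric_space "frame_pairs :: 'h frame_pair set" frame_dist
    by (rule Metric_space_frame_pairs[OF assms(1)])
  have pt: "(Phi A B x, adj U) \<in> total_space \<longleftrightarrow> B x = adj U o\<^sub>L A x o\<^sub>L U"
    if x: "x \<in> topspace X" and U: "U \<in> unitaries" for x U
  proof (rule Phi_in_total_space_iff[OF _ _ _ _ _ _ U])
    show "Phi A B x \<in> frame_pairs"
      using continuous_map_image_subset_topspace[OF assms(11)] x
      by (auto simp: frame_topology_def)
  qed (use assms x in \<open>auto simp: compact_families_def multiplicity_free_def\<close>)
  show ?thesis
  proof
    assume "strongly_unitarily_equivalent X A B"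
    then obtain U where U: "U \<in> strong_unitary_families X"
      and BU: "\<And>x. x \<in> topspace X \<Longrightarrow> B x = adj (U x) o\<^sub>L A x o\<^sub>L U x"
      unfolding strongly_unitarily_equivalent_def by blast
    have "(Phi A B x, adj (U x)) \<in> total_space" if "x \<in> topspace X" for x
      using pt[OF that] BU[OF that] U that unfolding strong_unitary_families_def by blast
    then have "continuous_map X total_topology (\<lambda>x. (Phi A B x, adj (U x)))"
      using strong_unitary_families_adj[OF U]
      by (simp add: continuous_map_total_topology_iff[OF assms(11)])
    then show "\<exists>\<Psi>. continuous_map X total_topology \<Psi> \<and>
        (\<forall>x\<in>topspace X. bundle_proj (\<Psi> x) = Phi A B x)"
      by (intro exI[of _ "\<lambda>x. (Phi A B x, adj (U x))"]) (simp add: bundle_proj_def)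
  next
    assume "\<exists>\<Psi>. continuous_map X total_topology \<Psi> \<and>
        (\<forall>x\<in>topspace X. bundle_proj (\<Psi> x) = Phi A B x)"
    then obtain \<Psi> where \<Psi>: "continuous_map X total_topology \<Psi>"
      "\<And>x. x \<in> topspace X \<Longrightarrow> fst (\<Psi> x) = Phi A B x"
      unfolding bundle_proj_def by blast
    define W where "W = snd \<circ> \<Psi>"
    have "continuous_map X total_topology (\<lambda>x. (Phi A B x, W x))"
      by (rule continuous_map_eq[OF \<Psi>(1)]) (simp add: W_def prod_eq_iff \<Psi>(2))
    then have W: "W \<in> strong_unitary_families X"
      and tot: "\<And>x. x \<in> topspace X \<Longrightarrow> (Phi A B x, W x) \<in> total_space"
      by (auto simp: continuous_map_total_topology_iff[OF assms(11)])
    have WU: "W x \<in> unitaries" if "x \<in> topspace X" for x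
      using W that unfolding strong_unitary_families_def by blast
    have "B x = adj (adj (W x)) o\<^sub>L A x o\<^sub>L adj (W x)" if x: "x \<in> topspace X" for x
      using pt[OF x adj_unitary[OF WU[OF x]]] tot[OF x] unitariesD(3)[OF WU[OF x]] by simp
    then show "strongly_unitarily_equivalent X A B"
      unfolding strongly_unitarily_equivalent_def
      by (intro bexI[OF _ strong_unitary_families_adj[OF W]] ballI)
  qed
qed

end
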